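(* Let $p$ be a prime and $N$ a positive integer not divisible by $p$. For all integers $\alpha\ge1$ and $n\ge0$, $$c\phi_{p^\alpha N}(n)\equiv c\phi_{p^{\alpha-1}N}(n/p)\pmod{p^{2\alpha}};$$ equivalently, $c\phi_{p^\alpha N}(pn+r)\equiv0\pmod{p^{2\alpha}}$ for $1\le r\le p-1$, and $c\phi_{p^\alpha N}(pn)\equiv c\phi_{p^{\alpha-1}N}(n)\pmod{p^{2\alpha}}$.
   Context: A $k$-colored generalized Frobenius symbol is a two-row array with $d\ge 0$ columns whose entries are colored nonnegative integers $\ell_c$ ($\ell\ge 0$, color $c\in\{1,\dots,k\}$), each row strictly decreasing with respect to the total order $0_1\prec 0_2\prec\cdots\prec 0_k\prec 1_1\prec\cdots\prec 1_k\prec 2_1\prec\cdots$. It is a $k$-colored generalized Frobenius partition of $n=d+\sum(\text{integer values of all entries})$; $c\phi_k(n)$ is the number of such partitions of $n$ (with $c\phi_k(0)=1$), and by convention $c\phi_k(x)=0$ if $x$ is not an integer. For $k=1$, $c\phi_1(n)=p(n)$, the ordinary partition function. *)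

theory Defs
  imports Complex_Main "HOL-Computational_Algebra.Primes" "HOL-Number_Theory.Cong"
begin

text \<open>
  The colored integer \<open>\<ell>\<^sub>c\<close> is encoded as the pair \<open>(\<ell>, c)\<close>; the order on
  colored integers is then the lexicographic one.
\<close>

definition colored_less :: "nat \<times> nat \<Rightarrow> nat \<times> nat \<Rightarrow> bool" where
  "colored_less x y \<longleftrightarrow> (x, y) \<in> less_than <*lex*> less_than"

definition frobenius_row :: "nat \<Rightarrow> (nat \<times> nat) list \<Rightarrow> bool" where
  "frobenius_row k xs \<longleftrightarrow>
     (\<forall>(l, c) \<in> set xs. c \<in> {1..k}) \<and> sorted_wrt (\<lambda>x y. colored_less y x) xs"

definition frobenius_symbols :: "nat \<Rightarrow> ((nat \<times> nat) list \<times> (nat \<times> nat) list) set" where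
  "frobenius_symbols k =
     {(a, b). length a = length b \<and> frobenius_row k a \<and> frobenius_row k b}"

definition symbol_size :: "(nat \<times> nat) list \<times> (nat \<times> nat) list \<Rightarrow> nat" where
  "symbol_size = (\<lambda>(a, b). length a + sum_list (map fst a) + sum_list (map fst b))"

definition frobenius_partitions ::
  "nat \<Rightarrow> nat \<Rightarrow> ((nat \<times> nat) list \<times> (nat \<times> nat) list) set" where
  "frobenius_partitions k n = {S \<in> frobenius_symbols k. symbol_size S = n}"

definition cphi :: "nat \<Rightarrow> nat \<Rightarrow> nat" where
  "cphi k n = card (frobenius_partitions k n)"

text \<open>
  The convention \<open>c\<phi>\<^sub>k(x) = 0\<close> for non-integral \<open>x\<close>; the value at negative
  integers is also \<open>0\<close>.
\<close>

definition cphi_rat :: "nat \<Rightarrow> rat \<Rightarrow> nat" where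
  "cphi_rat k x = (if x \<in> \<nat> then cphi k (nat \<lfloor>x\<rfloor>) else 0)"

lemma cphi_rat_of_nat [simp]: "cphi_rat k (of_nat n) = cphi k n"
  by (simp add: cphi_rat_def)

text \<open>Finiteness ensures that \<open>card\<close> really counts in the definition of \<open>cphi\<close>.\<close>

lemma finite_frobenius_partitions: "finite (frobenius_partitions k n)"
proof -
  let ?R = "{xs. set xs \<subseteq> {..n} \<times> {1..k} \<and> length xs \<le> n}"
  have "finite ?R"
    by (rule finite_lists_length_le) auto
  moreover have "frobenius_partitions k n \<subseteq> ?R \<times> ?R"
  proof
    fix S assume S: "S \<in> frobenius_partitions k n"
    obtain a b where ab: "S = (a, b)"
      by (cases S)
    have row: "frobenius_row k a" "frobenius_row k b" and len: "length a = length b"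
      and size: "length a + sum_list (map fst a) + sum_list (map fst b) = n"
      using S by (auto simp: ab frobenius_partitions_def frobenius_symbols_def symbol_size_def)
    have entry: "x \<in> {..n} \<times> {1..k}"
      if "x \<in> set xs" "frobenius_row k xs" "sum_list (map fst xs) \<le> n" for x xs
    proof -
      have "fst x \<le> sum_list (map fst xs)"
        using that(1) by (intro member_le_sum_list) auto
      then show ?thesis
        using that by (cases x) (auto simp: frobenius_row_def)
    qed
    show "S \<in> ?R \<times> ?R"
      using row len size entry[of _ a] entry[of _ b] by (auto simp: ab subset_iff)
  qed
  ultimately show ?thesis
    by (meson finite_SigmaI finite_subset)
qed

lemma cphi_0 [simp]: "cphi k 0 = 1"
proof -
  have "frobenius_partitions k 0 = {([], [])}"
    by (auto simp: frobenius_partitions_def frobenius_symbols_def symbol_size_def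
        frobenius_row_def)
  then show ?thesis
    by (simp add: cphi_def)
qed

end

theory Submission
  imports Defs "HOL-Computational_Algebra.Polynomial" "HOL-Library.Product_Lexorder" "HOL-Library.FuncSet"
begin

text \<open>
  Recording for every integer and each row how many colors occur gives
  \<open>c\<phi>\<^sub>k(n) = \<Sum>\<^sub>f \<Prod>\<^sub>x (k choose f x)\<close>, where the multiplicities \<open>f\<close> have total charge \<open>0\<close>
  (both rows have the same length) and total weight \<open>n\<close>. Let \<open>k = p K\<close> with \<open>K = p\<^sup>a N\<close> and
  \<open>a = \<alpha> - 1\<close>. A factor with \<open>p \<nmid> f x\<close> is divisible by \<open>p\<^sup>\<alpha>\<close>, and charge \<open>0\<close> rules out exactly
  one such \<open>x\<close>; so modulo \<open>p\<close> to the power \<open>2 \<alpha>\<close> only the terms \<open>f = p g\<close> survive. For these,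
  \<open>(p K choose p g) \<equiv> (K choose g)\<close> holds to the same modulus if \<open>p\<close> is odd or \<open>g\<close> is even. If
  \<open>p = 2\<close> and \<open>g\<close> is odd, the sign is wrong and one factor \<open>2\<close> is lost, but since the total charge
  is \<open>0\<close> such \<open>g x\<close> occur in even number, and for \<open>\<alpha> \<ge> 2\<close> each of them contributes an even
  factor; for \<open>\<alpha> = 1\<close> the reflection \<open>g \<mapsto> K - g\<close> reduces to even \<open>g\<close>.
\<close>

subsection \<open>Congruences for binomial coefficients\<close>

definition nonmult :: "nat \<Rightarrow> nat \<Rightarrow> nat set" where
  "nonmult p g = {i. i < p * g \<and> \<not> p dvd i}"

lemma finite_nonmult [simp]: "finite (nonmult p g)"
  by (rule finite_subset[of _ "{..<p * g}"]) (auto simp: nonmult_def)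

lemma lessThan_mult_eq_nonmult_Un:
  assumes "p > 0"
  shows "{..<p * g} = nonmult p g \<union> (*) p ` {..<g}" "nonmult p g \<inter> (*) p ` {..<g} = {}"
  using assms by (auto simp: nonmult_def elim!: dvdE)

lemma card_nonmult:
  assumes "p > 0"
  shows "card (nonmult p g) = g * (p - 1)"
proof -
  have "p * g = card {..<p * g}" by simp
  also have "\<dots> = card (nonmult p g) + card ((*) p ` {..<g})"
    using lessThan_mult_eq_nonmult_Un[OF assms, of g] by (simp add: card_Un_disjoint)
  also have "card ((*) p ` {..<g}) = g"
    using assms by (subst card_image) (auto simp: inj_on_def)
  finally show ?thesis by (simp add: algebra_simps)
qed

text \<open>Kept as a polynomial because its values at \<open>p * g\<close> and \<open>p * K\<close>
  are compared below through the expansion at 0.\<close>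

definition nonmult_poly :: "nat \<Rightarrow> nat \<Rightarrow> int poly" where
  "nonmult_poly p g = (\<Prod>i\<in>nonmult p g. [:- int i, 1:])"

lemma poly_nonmult_poly: "poly (nonmult_poly p g) x = (\<Prod>i\<in>nonmult p g. x - int i)"
  by (simp add: nonmult_poly_def poly_prod)

lemma binomial_mult_fact_int:
  "int (n choose k) * fact k = (\<Prod>i<k. int n - int i)"
proof -
  have "real_of_int (int (n choose k) * fact k) = real_of_int (\<Prod>i<k. int n - int i)"
    using gbinomial_mult_fact[of k "real n"]
    by (simp add: binomial_gbinomial mult.commute lessThan_atLeast0)
  then show ?thesis by (simp only: of_int_eq_iff)
qed

text \<open>The factors with \<open>i = p * j\<close> contribute \<open>p * (x - j)\<close>; the
  remaining ones make up \<open>nonmult_poly\<close>.\<close>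

lemma prod_mult_diff_split:
  assumes "p > 0"
  shows "(\<Prod>i<p * g. int p * x - int i) =
    int p ^ g * (\<Prod>j<g. x - int j) * poly (nonmult_poly p g) (int p * x)"
proof -
  have "(\<Prod>i<p * g. int p * x - int i) =
      poly (nonmult_poly p g) (int p * x) * (\<Prod>i\<in>(*) p ` {..<g}. int p * x - int i)"
    using lessThan_mult_eq_nonmult_Un[OF assms, of g]
    by (simp add: prod.union_disjoint poly_nonmult_poly)
  also have "(\<Prod>i\<in>(*) p ` {..<g}. int p * x - int i) = (\<Prod>j<g. int p * (x - int j))"
    using assms by (subst prod.reindex) (auto simp: inj_on_def algebra_simps)
  finally show ?thesis by (simp add: prod.distrib)
qed

text \<open>Quotient of the splittings of the falling factorials at \<open>K\<close> and at
  \<open>g\<close>, cross-multiplied to stay in the integers: the powers of \<open>p\<close> and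
  \<open>fact g\<close> cancel.\<close>

lemma binomial_mult_mult_poly:
  assumes "p > 0"
  shows "int ((p * K) choose (p * g)) * poly (nonmult_poly p g) (int (p * g)) =
    int (K choose g) * poly (nonmult_poly p g) (int (p * K))"
proof -
  let ?P = "poly (nonmult_poly p g)"
  have split: "int ((p * K) choose (p * g)) * fact (p * g) =
      int p ^ g * (int (K choose g) * fact g) * ?P (int (p * K))" for K
    using prod_mult_diff_split[OF assms, of "int K" g]
    by (simp add: binomial_mult_fact_int)
  \<comment> \<open>The case \<open>K = g\<close>, where both binomials are 1.\<close>
  have top: "fact (p * g) = int p ^ g * fact g * ?P (int (p * g))"
    using split[of g] by simp
  have "(int p ^ g * fact g) * (int ((p * K) choose (p * g)) * ?P (int (p * g))) =
      (int p ^ g * fact g) * (int (K choose g) * ?P (int (p * K)))"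
    using split[of K] unfolding top by (simp only: ac_simps)
  then show ?thesis
    using assms by (simp del: of_nat_mult)
qed

text \<open>The map from \<open>i\<close> to \<open>p * g - i\<close> permutes
  \<open>nonmult p g\<close>, so the value at \<open>p * g\<close> is the product of all
  \<open>i\<close>, while the value at 0 is the product of all \<open>- i\<close>.\<close>

lemma poly_nonmult_poly_reflect:
  "poly (nonmult_poly p g) (int (p * g)) = (- 1) ^ card (nonmult p g) * poly (nonmult_poly p g) 0"
proof -
  have "(\<Prod>i\<in>nonmult p g. int (p * g) - int i) = (\<Prod>i\<in>nonmult p g. int i)"
    by (rule prod.reindex_bij_witness[of _ "\<lambda>i. p * g - i" "\<lambda>i. p * g - i"])
      (auto simp: nonmult_def of_nat_diff dest: dvd_diffD1 intro!: diff_less Nat.gr0I)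
  then show ?thesis
    by (simp add: poly_nonmult_poly prod_uminus del: of_nat_mult flip: power_mult_distrib)
qed

text \<open>No factor \<open>p * g - i\<close> is divisible by \<open>p\<close>. Hence this value
  can be cancelled from divisibilities by powers of \<open>p\<close>.\<close>

lemma coprime_poly_nonmult_poly:
  assumes "prime p"
  shows "coprime (int p ^ m) (poly (nonmult_poly p g) (int (p * g)))"
proof -
  have "coprime (int p) (int (p * g) - int i)" if "i \<in> nonmult p g" for i
  proof -
    have "\<not> int p dvd int (p * g) - int i"
      using that by (simp add: nonmult_def dvd_diff_right_iff)
    then show ?thesis
      using assms by (simp add: prime_imp_coprime del: of_nat_mult)
  qed
  then show ?thesis
    by (simp add: poly_nonmult_poly prod_coprime_right del: of_nat_mult)
qed

section \<open>Comparison of \<open>p K choose p g\<close> with \<open>K choose g\<close> by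
  expansion to second order\<close>

lemma poly_second_order:
  fixes P :: "int poly"
  obtains c R where "\<And>x. poly P x = poly P 0 + x * (c + x * poly R x)"
proof -
  obtain a Q where P: "P = pCons a Q" by (cases P)
  obtain c R where Q: "Q = pCons c R" by (cases Q)
  show ?thesis by (rule that[of c R]) (simp add: P Q)
qed

text \<open>Absorption: for positive \<open>g\<close> the quotient is
  \<open>(K - 1) choose (g - 1)\<close>.\<close>

lemma mult_binomial_dvd:
  "int K dvd int g * int (K choose g)"
proof (cases g)
  case (Suc h)
  have "g * (K choose g) = K * ((K - 1) choose h)"
    using binomial_absorption[of h K] by (simp add: Suc)
  then show ?thesis by (metis dvd_triv_left of_nat_mult)
qed simp

lemma binomial_mult_mult_cong:
  assumes p: "prime p" and even: "even (g * (p - 1))" and K: "p ^ a dvd p * K"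
  shows "[int ((p * K) choose (p * g)) = int (K choose g)] (mod int p ^ (2 * a))"
proof (cases "g = 0")
  case False
  let ?P = "nonmult_poly p g"
  have p0: "p > 0" using p by (simp add: prime_gt_0_nat)
  obtain c R where P: "\<And>x. poly ?P x = poly ?P 0 + x * (c + x * poly R x)"
    using poly_second_order[of ?P] by blast
  \<comment> \<open>The symmetry \<open>i \<mapsto> p g - i\<close> of the roots makes the linear coefficient \<open>c\<close> divisible by \<open>p g\<close>;
    the factor \<open>g\<close> then turns \<open>K choose g\<close> into a multiple of \<open>K\<close>.\<close>
  have reflect: "poly ?P (int (p * g)) = poly ?P 0"
    using even by (simp add: poly_nonmult_poly_reflect card_nonmult[OF p0] del: of_nat_mult)
  have c: "c = - int (p * g) * poly R (int (p * g))"
    using P[of "int (p * g)"] reflect False p0 by simp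
  obtain m where m: "int g * int (K choose g) = int K * m"
    using mult_binomial_dvd[of K g] by (auto elim: dvdE)
  have "(int ((p * K) choose (p * g)) - int (K choose g)) * poly ?P (int (p * g)) =
      int (K choose g) * (poly ?P (int (p * K)) - poly ?P (int (p * g)))"
    using binomial_mult_mult_poly[OF p0, of K g] by (simp add: algebra_simps del: of_nat_mult)
  also have "\<dots> = int (K choose g) * (int (p * K) * (c + int (p * K) * poly R (int (p * K))))"
    by (subst P) (simp only: reflect add_diff_cancel_left')
  also have "\<dots> = int (p * K) * (int p * (- (int g * int (K choose g)) * poly R (int (p * g)) +
      int K * int (K choose g) * poly R (int (p * K))))"
    by (simp add: c algebra_simps)
  also have "\<dots> = int (p * K) * int (p * K) *
      (- m * poly R (int (p * g)) + int (K choose g) * poly R (int (p * K)))"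
    by (simp only: m) (simp add: algebra_simps)
  finally have "int (p * K) * int (p * K) dvd
      (int ((p * K) choose (p * g)) - int (K choose g)) * poly ?P (int (p * g))"
    by simp
  moreover have "int p ^ (2 * a) dvd int (p * K) * int (p * K)"
  proof -
    have "int p ^ a dvd int (p * K)" using K by (metis of_nat_dvd_iff of_nat_power)
    then show ?thesis by (simp only: mult_2 power_add mult_dvd_mono)
  qed
  ultimately have "int p ^ (2 * a) dvd
      (int ((p * K) choose (p * g)) - int (K choose g)) * poly ?P (int (p * g))"
    by (rule dvd_trans[rotated])
  then show ?thesis
    using coprime_poly_nonmult_poly[OF p] by (simp add: cong_iff_dvd_diff coprime_dvd_mult_left_iff)
qed simp

text \<open>\<open>K\<close> divides \<open>g * (K choose g)\<close>, and \<open>g\<close> is prime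
  to \<open>p\<close>.\<close>

lemma prime_power_dvd_binomial:
  assumes "prime p" "p ^ a dvd K" "\<not> p dvd g"
  shows "p ^ a dvd (K choose g)"
proof -
  have "K dvd g * (K choose g)"
    using mult_binomial_dvd[of K g] by (metis of_nat_dvd_iff of_nat_mult)
  then have "p ^ a dvd g * (K choose g)" using assms(2) dvd_trans by blast
  moreover have "coprime (p ^ a) g" using assms by (simp add: prime_imp_coprime)
  ultimately show ?thesis by (simp add: coprime_dvd_mult_right_iff)
qed

text \<open>For odd \<open>g\<close> the set \<open>nonmult 2 g\<close> has odd size, so reflection
  reverses the sign and the constant terms cancel in the sum instead of the difference. The
  polynomial supplies a factor \<open>2 * K\<close>, and \<open>K choose g\<close> supplies another
  \<open>2 ^ a\<close>.\<close>

lemma binomial_double_double_cong_odd: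
  assumes g: "odd g" and K: "2 ^ a dvd K"
  shows "[int ((2 * K) choose (2 * g)) = - int (K choose g)] (mod 2 ^ (2 * a + 1))"
proof -
  let ?P = "nonmult_poly 2 g"
  obtain c R where P: "\<And>x. poly ?P x = poly ?P 0 + x * (c + x * poly R x)"
    using poly_second_order[of ?P] by blast
  have reflect: "poly ?P (int (2 * g)) = - poly ?P 0"
    using g by (simp add: poly_nonmult_poly_reflect card_nonmult del: of_nat_mult)
  have "(int ((2 * K) choose (2 * g)) + int (K choose g)) * poly ?P (int (2 * g)) =
      int (K choose g) * (poly ?P (int (2 * K)) + poly ?P (int (2 * g)))"
    using binomial_mult_mult_poly[of 2 K g] by (simp add: algebra_simps del: of_nat_mult)
  also have "\<dots> = int (K choose g) * (int (2 * K) * (c + int (2 * K) * poly R (int (2 * K))))"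
    by (subst P) (simp only: reflect, simp)
  finally have "int (K choose g) * int (2 * K) dvd
      (int ((2 * K) choose (2 * g)) + int (K choose g)) * poly ?P (int (2 * g))"
    by (simp add: mult.assoc)
  moreover have "2 ^ (2 * a + 1) dvd int (K choose g) * int (2 * K)"
  proof -
    have "2 ^ a dvd (K choose g)"
      using prime_power_dvd_binomial[OF two_is_prime_nat K] g by blast
    then have "2 ^ a * (2 * 2 ^ a) dvd (K choose g) * (2 * K)"
      using K by (intro mult_dvd_mono) auto
    then have "int (2 ^ a * (2 * 2 ^ a)) dvd int ((K choose g) * (2 * K))"
      by (simp only: of_nat_dvd_iff)
    then show ?thesis by (simp add: power_mult power2_eq_square power_mult_distrib ac_simps)
  qed
  ultimately have "2 ^ (2 * a + 1) dvd
      (int ((2 * K) choose (2 * g)) + int (K choose g)) * poly ?P (int (2 * g))"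
    by (rule dvd_trans[rotated])
  then show ?thesis
    using coprime_poly_nonmult_poly[OF two_is_prime_nat, of "2 * a + 1" g]
    by (simp add: cong_iff_dvd_diff coprime_dvd_mult_left_iff)
qed

section \<open>Products of binomial coefficients, with the sign problem at the prime 2\<close>

lemma prod_binomial_cong:
  assumes p: "prime p" and N: "\<not> p dvd N" and fin: "finite X"
    and g: "\<And>x. x \<in> X \<Longrightarrow> g x \<le> p ^ a * N" and even: "p = 2 \<Longrightarrow> even (\<Sum>x\<in>X. g x)"
  defines "K \<equiv> p ^ a * N"
  shows "[(\<Prod>x\<in>X. int ((p * K) choose (p * g x))) = (\<Prod>x\<in>X. int (K choose g x))]
    (mod int p ^ (2 * Suc a))"
proof -
  have cong: "[int ((p * K) choose (p * h)) = int (K choose h)] (mod int p ^ (2 * Suc a))"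
    if "even (h * (p - 1))" for h
    using that by (intro binomial_mult_mult_cong p) (auto simp: K_def)
  show ?thesis
  proof (cases "p = 2")
    case False
    then have "even (p - 1)" using p prime_odd_nat[of p] by (auto simp: prime_gt_0_nat dest: prime_ge_2_nat)
    then show ?thesis by (intro cong_prod cong) simp
  next
    case p2: True
    show ?thesis
    proof (cases a)
      case 0
      have "[int ((p * K) choose (p * g x)) = int (K choose g x)] (mod int p ^ (2 * Suc a))"
        if x: "x \<in> X" for x
      proof (cases "even (g x)")
        case False
        \<comment> \<open>Here \<open>K = N\<close> is odd, so \<open>K - g x\<close> is even, and
          the symmetry of both binomials transfers the congruence from \<open>K - g x\<close> to
          \<open>g x\<close>.\<close>
        have le: "g x \<le> K" using g[OF x] by (simp add: K_def)
        have "even (K - g x)" using False N 0 p2 by (simp add: K_def)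
        then have "[int ((p * K) choose (p * (K - g x))) = int (K choose (K - g x))]
            (mod int p ^ (2 * Suc a))"
          by (intro cong) simp
        moreover have "(p * K) choose (p * (K - g x)) = (p * K) choose (p * g x)"
          using binomial_symmetric[of "p * g x" "p * K"] le by (simp add: diff_mult_distrib2)
        ultimately show ?thesis using binomial_symmetric[OF le] by simp
      qed (intro cong, simp)
      then show ?thesis by (rule cong_prod)
    next
      case (Suc b)
      define Od where "Od = {x \<in> X. odd (g x)}"
      have Od: "finite Od" "Od \<subseteq> X" using fin by (auto simp: Od_def)
      have even_sum: "even (card Od)"
        using even[OF p2] fin even_sum_iff[of X g] by (auto simp: Od_def)
      have "[(\<Prod>x\<in>X - Od. int ((p * K) choose (p * g x))) = (\<Prod>x\<in>X - Od. int (K choose g x))]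
          (mod int p ^ (2 * Suc a))"
        by (intro cong_prod cong) (auto simp: Od_def)
      moreover have "[(\<Prod>x\<in>Od. int ((p * K) choose (p * g x))) = (\<Prod>x\<in>Od. int (K choose g x))]
          (mod int p ^ (2 * Suc a))"
      proof (cases "Od = {}")
        case False
        \<comment> \<open>Two odd entries give two factors 2, exactly what is needed to pass from
          the modulus \<open>2 ^ (2 * a)\<close> for the halved binomials to
          \<open>2 ^ (2 * Suc a)\<close>.\<close>
        have card: "card Od \<ge> 2"
          using even_sum False Od by (cases "card Od") (auto simp: Suc_le_eq elim: oddE)
        define s where "s x = int (K choose g x) div 2" for x
        define t where "t x = int ((p * K) choose (p * g x)) div 2" for x
        have s: "int (K choose g x) = 2 * s x" and t: "int ((p * K) choose (p * g x)) = 2 * t x"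
          and st: "[t x = - s x] (mod 2 ^ (2 * a))" if "x \<in> Od" for x
        proof -
          have odd: "odd (g x)" using that by (simp add: Od_def)
          have "2 ^ a dvd (K choose g x)"
            using odd by (intro prime_power_dvd_binomial) (auto simp: K_def p2)
          then have ev: "even (K choose g x)"
            using Suc by (auto intro: dvd_trans[rotated])
          then show s': "int (K choose g x) = 2 * s x" by (simp add: s_def)
          have c: "[int ((2 * K) choose (2 * g x)) = - int (K choose g x)] (mod 2 ^ (2 * a + 1))"
            using odd by (intro binomial_double_double_cong_odd) (auto simp: K_def p2)
          then have d: "2 * 2 ^ (2 * a) dvd int ((2 * K) choose (2 * g x)) + int (K choose g x)"
            by (simp add: cong_iff_dvd_diff)
          then have "even (int ((2 * K) choose (2 * g x)) + int (K choose g x))"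
            by (rule dvd_mult_left)
          then show t': "int ((p * K) choose (p * g x)) = 2 * t x"
            using ev by (simp add: t_def p2)
          have "2 * 2 ^ (2 * a) dvd 2 * (t x + s x)"
            using d by (simp only: s' t'[unfolded p2] distrib_left)
          then have "2 ^ (2 * a) dvd t x + s x"
            unfolding dvd_mult_cancel_left by simp
          then show "[t x = - s x] (mod 2 ^ (2 * a))"
            by (simp add: cong_iff_dvd_diff)
        qed
        have "[(\<Prod>x\<in>Od. t x) = (\<Prod>x\<in>Od. - s x)] (mod 2 ^ (2 * a))"
          by (intro cong_prod st)
        \<comment> \<open>The signs cancel because \<open>card Od\<close> is even.\<close>
        then have "2 ^ (2 * a) dvd (\<Prod>x\<in>Od. t x) - (\<Prod>x\<in>Od. s x)"
          using even_sum by (simp add: cong_iff_dvd_diff prod_uminus)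
        moreover have "(2::int) ^ 2 dvd 2 ^ card Od"
          using card by (rule le_imp_power_dvd)
        ultimately have "2 ^ 2 * 2 ^ (2 * a) dvd
            2 ^ card Od * ((\<Prod>x\<in>Od. t x) - (\<Prod>x\<in>Od. s x))"
          by (intro mult_dvd_mono)
        moreover have "(\<Prod>x\<in>Od. int ((p * K) choose (p * g x))) = 2 ^ card Od * (\<Prod>x\<in>Od. t x)"
          by (simp add: t prod.distrib cong: prod.cong)
        moreover have "(\<Prod>x\<in>Od. int (K choose g x)) = 2 ^ card Od * (\<Prod>x\<in>Od. s x)"
          by (simp add: s prod.distrib cong: prod.cong)
        ultimately show ?thesis
          by (simp add: cong_iff_dvd_diff p2 right_diff_distrib power_add)
      qed simp
      ultimately show ?thesis
        unfolding prod.subset_diff[OF Od(2) fin] by (rule cong_mult)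
    qed
  qed
qed

subsection \<open>Counting Frobenius symbols by multiplicities\<close>

lemma colored_less_iff: "colored_less x y \<longleftrightarrow> x < y"
  by (cases x; cases y) (auto simp: colored_less_def)

lemma frobenius_row_iff:
  "frobenius_row k xs \<longleftrightarrow> set xs \<subseteq> UNIV \<times> {1..k} \<and> sorted_wrt (<) (rev xs)"
  by (auto simp: frobenius_row_def colored_less_iff sorted_wrt_rev)

definition row_of_set :: "(nat \<times> nat) set \<Rightarrow> (nat \<times> nat) list" where
  "row_of_set A = rev (sorted_list_of_set A)"

lemma set_row_of_set [simp]: "finite A \<Longrightarrow> set (row_of_set A) = A"
  by (simp add: row_of_set_def)

lemma frobenius_row_row_of_set:
  "finite A \<Longrightarrow> A \<subseteq> UNIV \<times> {1..k} \<Longrightarrow> frobenius_row k (row_of_set A)"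
  by (simp add: frobenius_row_iff) (simp add: row_of_set_def)

lemma row_of_set_set:
  assumes "frobenius_row k xs"
  shows "row_of_set (set xs) = xs"
proof -
  have "sorted_list_of_set (set xs) = rev xs"
    using assms by (intro strict_sorted_equal) (auto simp: frobenius_row_iff)
  then show ?thesis by (simp add: row_of_set_def)
qed

text \<open>A strictly decreasing row has distinct entries, so sums over the list are sums over its
  set, which is then grouped by integer value.\<close>

lemma frobenius_row_sums:
  assumes row: "frobenius_row k xs" and le: "fst ` set xs \<subseteq> {..M}"
  shows "length xs = (\<Sum>i\<le>M. card {c. (i, c) \<in> set xs})"
    and "sum_list (map fst xs) = (\<Sum>i\<le>M. i * card {c. (i, c) \<in> set xs})"
proof -
  have dist: "distinct xs"
    using row strict_sorted_iff[of "rev xs"] by (simp add: frobenius_row_iff)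
  have fin: "finite {c. (i, c) \<in> set xs}" for i
    by (rule finite_subset[of _ "snd ` set xs"]) force+
  have sigma: "set xs = Sigma {..M} (\<lambda>i. {c. (i, c) \<in> set xs})"
    using le by force
  have "length xs = card (set xs)"
    using dist by (simp add: distinct_card)
  also have "\<dots> = (\<Sum>i\<le>M. card {c. (i, c) \<in> set xs})"
    by (subst sigma, subst card_SigmaI) (use fin in auto)
  finally show "length xs = (\<Sum>i\<le>M. card {c. (i, c) \<in> set xs})" .
  have "sum_list (map fst xs) = sum fst (set xs)"
    using dist by (simp add: sum_list_distinct_conv_sum_set)
  also have "\<dots> = (\<Sum>i\<le>M. \<Sum>c\<in>{c. (i, c) \<in> set xs}. i)"
    by (subst sigma, subst sum.Sigma) (use fin in \<open>auto intro!: sum.cong\<close>)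
  finally show "sum_list (map fst xs) = (\<Sum>i\<le>M. i * card {c. (i, c) \<in> set xs})"
    by (simp add: mult.commute)
qed

text \<open>
  The pair \<open>(i, t)\<close> stands for the integer \<open>i\<close> in the top row if \<open>t\<close> is true and in the bottom row
  otherwise. Top row entries weigh one more than their value, which accounts for the number
  of columns in the size of a symbol.
\<close>

fun charge :: "nat \<times> bool \<Rightarrow> int" where
  "charge (i, b) = (if b then 1 else - 1)"

fun entry_weight :: "nat \<times> bool \<Rightarrow> nat" where
  "entry_weight (i, b) = (if b then Suc i else i)"

text \<open>The bound \<open>M\<close> makes the index set finite. Entries of a symbol of size
  \<open>n\<close> are at most \<open>n\<close>, so any \<open>M\<close> that is at least
  \<open>n\<close> loses nothing.\<close>

definition multiplicities :: "nat \<Rightarrow> nat \<Rightarrow> nat \<Rightarrow> (nat \<times> bool \<Rightarrow> nat) set" where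
  "multiplicities M k n = {f \<in> ({..M} \<times> UNIV) \<rightarrow>\<^sub>E {..k}.
     (\<Sum>x\<in>{..M} \<times> UNIV. charge x * int (f x)) = 0 \<and>
     (\<Sum>x\<in>{..M} \<times> UNIV. entry_weight x * f x) = n}"

lemma finite_multiplicities: "finite (multiplicities M k n)"
  by (rule finite_subset[of _ "({..M} \<times> UNIV) \<rightarrow>\<^sub>E {..k}"])
    (auto simp: multiplicities_def intro!: finite_PiE)

lemma sum_times_bool:
  "(\<Sum>x\<in>A \<times> (UNIV :: bool set). h x) = (\<Sum>i\<in>A. h (i, True)) + (\<Sum>i\<in>A. h (i, False))"
  by (simp add: sum.cartesian_product' UNIV_bool sum.distrib add.commute)

definition color_sets ::
  "nat \<Rightarrow> (nat \<times> nat) list \<times> (nat \<times> nat) list \<Rightarrow> nat \<times> bool \<Rightarrow> nat set" where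
  "color_sets M = (\<lambda>(a, b). \<lambda>(i, t) \<in> {..M} \<times> UNIV. {c. (i, c) \<in> set (if t then a else b)})"

text \<open>The total charge is the difference of the row lengths. Once these agree, the extra 1 in
  the weight of each top entry adds up to the number of columns.\<close>

lemma card_color_sets_in_multiplicities_iff:
  assumes rows: "frobenius_row k a" "frobenius_row k b"
    and le: "fst ` set a \<subseteq> {..M}" "fst ` set b \<subseteq> {..M}"
  shows "(\<lambda>x\<in>{..M} \<times> UNIV. card (color_sets M (a, b) x)) \<in> multiplicities M k n \<longleftrightarrow>
    (a, b) \<in> frobenius_partitions k n"
proof -
  have "card {c. (i, c) \<in> set xs} \<le> k" if "frobenius_row k xs" for i xs
  proof -
    have "{c. (i, c) \<in> set xs} \<subseteq> {1..k}" using that by (auto simp: frobenius_row_iff)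
    then show ?thesis using card_mono[of "{1..k}"] by force
  qed
  then have "(\<lambda>x\<in>{..M} \<times> UNIV. card (color_sets M (a, b) x)) \<in> ({..M} \<times> UNIV) \<rightarrow>\<^sub>E {..k}"
    using rows by (auto simp: color_sets_def)
  then show ?thesis
    using rows frobenius_row_sums[OF rows(1) le(1)] frobenius_row_sums[OF rows(2) le(2)]
    by (auto simp: multiplicities_def sum_times_bool frobenius_partitions_def frobenius_symbols_def
        symbol_size_def color_sets_def sum_negf sum.distrib simp flip: of_nat_sum)
qed

lemma bij_betw_color_sets:
  assumes "n \<le> M"
  shows "bij_betw (color_sets M) (frobenius_partitions k n)
    {T \<in> ({..M} \<times> UNIV) \<rightarrow>\<^sub>E Pow {1..k}. (\<lambda>x\<in>{..M} \<times> UNIV. card (T x)) \<in> multiplicities M k n}"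
    (is "bij_betw _ _ ?T")
proof -
  \<comment> \<open>The inverse map: collect the colored integers of each row and list them in
    decreasing order.\<close>
  define rows where "rows T = (row_of_set (Sigma {..M} (\<lambda>i. T (i, True))),
    row_of_set (Sigma {..M} (\<lambda>i. T (i, False))))" for T :: "nat \<times> bool \<Rightarrow> nat set"
  have part: "frobenius_row k a" "frobenius_row k b" "fst ` set a \<subseteq> {..M}" "fst ` set b \<subseteq> {..M}"
    if ab: "(a, b) \<in> frobenius_partitions k n" for a b
  proof -
    have size: "length a + sum_list (map fst a) + sum_list (map fst b) = n"
      using ab by (simp add: frobenius_partitions_def symbol_size_def)
    have "fst x \<le> M" if "x \<in> set xs" "sum_list (map fst xs) \<le> n" for x and xs :: "(nat \<times> nat) list"
      using member_le_sum_list[of "fst x" "map fst xs"] that assms by auto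
    then show "frobenius_row k a" "frobenius_row k b" "fst ` set a \<subseteq> {..M}" "fst ` set b \<subseteq> {..M}"
      using ab size by (fastforce simp: frobenius_partitions_def frobenius_symbols_def)+
  qed
  have tab: "finite (Sigma {..M} (\<lambda>i. T (i, t)))" "Sigma {..M} (\<lambda>i. T (i, t)) \<subseteq> UNIV \<times> {1..k}"
    if "T \<in> ({..M} \<times> UNIV) \<rightarrow>\<^sub>E Pow {1..k}" for T :: "nat \<times> bool \<Rightarrow> nat set" and t
    using that by (fastforce intro!: finite_SigmaI intro: finite_subset[of _ "{1..k}"])+
  have inverse: "color_sets M (rows T) = T" if T: "T \<in> ({..M} \<times> UNIV) \<rightarrow>\<^sub>E Pow {1..k}" for T
  proof
    fix x
    show "color_sets M (rows T) x = T x"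
      using T tab[OF T]
      by (cases x) (auto simp: color_sets_def rows_def PiE_def extensional_def)
  qed
  show ?thesis
  proof (rule bij_betw_byWitness[where f' = rows])
    show "\<forall>s\<in>frobenius_partitions k n. rows (color_sets M s) = s"
    proof safe
      fix a b assume ab: "(a, b) \<in> frobenius_partitions k n"
      have "Sigma {..M} (\<lambda>i. color_sets M (a, b) (i, True)) = set a"
        "Sigma {..M} (\<lambda>i. color_sets M (a, b) (i, False)) = set b"
        using part[OF ab] by (force simp: color_sets_def)+
      then show "rows (color_sets M (a, b)) = (a, b)"
        using part[OF ab] by (simp add: rows_def row_of_set_set)
    qed
    show "\<forall>T\<in>?T. color_sets M (rows T) = T"
      using inverse by blast
    show "color_sets M ` frobenius_partitions k n \<subseteq> ?T"
    proof (rule image_subsetI)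
      fix s assume "s \<in> frobenius_partitions k n"
      then obtain a b where s: "s = (a, b)" and ab: "(a, b) \<in> frobenius_partitions k n"
        by (cases s) auto
      have "(\<lambda>x\<in>{..M} \<times> UNIV. card (color_sets M (a, b) x)) \<in> multiplicities M k n"
        using ab card_color_sets_in_multiplicities_iff[OF part[OF ab]] by blast
      moreover have "color_sets M (a, b) \<in> ({..M} \<times> UNIV) \<rightarrow>\<^sub>E Pow {1..k}"
        using part(1,2)[OF ab] by (force simp: color_sets_def frobenius_row_iff PiE_iff subset_iff)
      ultimately show "color_sets M s \<in> ?T" by (simp add: s)
    qed
    show "rows ` ?T \<subseteq> frobenius_partitions k n"
    proof (rule image_subsetI)
      fix T assume "T \<in> ?T"
      then have T: "T \<in> ({..M} \<times> UNIV) \<rightarrow>\<^sub>E Pow {1..k}"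
        and *: "(\<lambda>x\<in>{..M} \<times> UNIV. card (T x)) \<in> multiplicities M k n"
        by auto
      note t = tab[OF T]
      obtain a b where ab: "rows T = (a, b)" by (cases "rows T")
      have "frobenius_row k a" "frobenius_row k b" "fst ` set a \<subseteq> {..M}" "fst ` set b \<subseteq> {..M}"
        using ab t by (auto simp: rows_def frobenius_row_row_of_set)
      from card_color_sets_in_multiplicities_iff[OF this, of n]
      show "rows T \<in> frobenius_partitions k n"
        using * inverse[OF T] by (simp add: ab)
    qed
  qed
qed

text \<open>Group the families of color sets by their cardinalities \<open>f\<close>: each
  \<open>x\<close> then allows any \<open>f x\<close> of the \<open>k\<close> colors, independently
  of the others.\<close>

lemma cphi_eq_sum_binomials:
  assumes "n \<le> M"
  shows "cphi k n = (\<Sum>f\<in>multiplicities M k n. \<Prod>x\<in>{..M} \<times> UNIV. k choose f x)"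
proof -
  let ?X = "{..M} \<times> (UNIV :: bool set)"
  define B where "B f = (\<Pi>\<^sub>E x\<in>?X. {A. A \<subseteq> {1..k} \<and> card A = f x})" for f
  have finB: "finite (B f)" for f
    unfolding B_def by (intro finite_PiE) auto
  \<comment> \<open>A family \<open>T\<close> determines its \<open>f\<close>, so the sets
    \<open>B f\<close> are disjoint.\<close>
  have f_eq: "f = (\<lambda>x\<in>?X. card (T x))" if "f \<in> multiplicities M k n" "T \<in> B f" for f T
  proof
    fix x
    show "f x = (\<lambda>x\<in>?X. card (T x)) x"
      using that by (cases x; cases "fst x \<le> M") (auto simp: B_def multiplicities_def PiE_iff extensional_def)
  qed
  have "cphi k n = card {T \<in> ?X \<rightarrow>\<^sub>E Pow {1..k}. (\<lambda>x\<in>?X. card (T x)) \<in> multiplicities M k n}"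
    unfolding cphi_def by (rule bij_betw_same_card[OF bij_betw_color_sets[OF assms]])
  also have "{T \<in> ?X \<rightarrow>\<^sub>E Pow {1..k}. (\<lambda>x\<in>?X. card (T x)) \<in> multiplicities M k n} =
      (\<Union>f\<in>multiplicities M k n. B f)"
  proof (intro equalityI subsetI)
    fix T assume "T \<in> {T \<in> ?X \<rightarrow>\<^sub>E Pow {1..k}. (\<lambda>x\<in>?X. card (T x)) \<in> multiplicities M k n}"
    then show "T \<in> (\<Union>f\<in>multiplicities M k n. B f)"
      by (intro UN_I[of "\<lambda>x\<in>?X. card (T x)"]) (auto simp: B_def PiE_iff)
  next
    fix T assume "T \<in> (\<Union>f\<in>multiplicities M k n. B f)"
    then obtain f where f: "f \<in> multiplicities M k n" "T \<in> B f" by blast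
    then have "(\<lambda>x\<in>?X. card (T x)) \<in> multiplicities M k n" using f_eq by metis
    then show "T \<in> {T \<in> ?X \<rightarrow>\<^sub>E Pow {1..k}. (\<lambda>x\<in>?X. card (T x)) \<in> multiplicities M k n}"
      using f(2) by (auto simp: B_def PiE_iff)
  qed
  also have "card \<dots> = (\<Sum>f\<in>multiplicities M k n. card (B f))"
    using f_eq by (intro card_UN_disjoint finite_multiplicities) (auto simp: finB)
  also have "\<dots> = (\<Sum>f\<in>multiplicities M k n. \<Prod>x\<in>?X. k choose f x)"
    by (simp add: B_def card_PiE n_subsets)
  finally show ?thesis .
qed

subsection \<open>Reduction to multiples of the prime\<close>

text \<open>If \<open>x\<close> were the only such index, the vanishing total charge would force
  \<open>p\<close> to divide \<open>f x\<close> up to sign.\<close>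

lemma two_nonmultiples:
  assumes f: "f \<in> multiplicities M k n" and x: "x \<in> {..M} \<times> UNIV" "\<not> p dvd f x"
  obtains y where "y \<in> {..M} \<times> UNIV" "y \<noteq> x" "\<not> p dvd f y"
proof -
  let ?X = "{..M} \<times> (UNIV :: bool set)"
  have "\<exists>y\<in>?X - {x}. \<not> p dvd f y"
  proof (rule ccontr)
    assume "\<not> ?thesis"
    then have all: "p dvd f y" if "y \<in> ?X - {x}" for y
      using that by blast
    have "charge x * int (f x) + (\<Sum>y\<in>?X - {x}. charge y * int (f y)) = 0"
      using f sum.remove[OF _ x(1), of "\<lambda>x. charge x * int (f x)"] by (simp add: multiplicities_def)
    moreover have "int p dvd (\<Sum>y\<in>?X - {x}. charge y * int (f y))"
      using all by (intro dvd_sum dvd_mult) auto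
    ultimately have "int p dvd charge x * int (f x)"
      by (simp add: add_eq_0_iff2)
    then show False
      using x(2) by (cases x) (auto split: if_splits)
  qed
  then show ?thesis using that by blast
qed

text \<open>Charge 0 makes the top and bottom totals equal, so the whole sum is twice one of
  them.\<close>

lemma even_sum_multiplicities:
  assumes "f \<in> multiplicities M k n"
  shows "even (\<Sum>x\<in>{..M} \<times> UNIV. f x)"
proof -
  have "int (\<Sum>i\<le>M. f (i, True)) = int (\<Sum>i\<le>M. f (i, False))"
    using assms by (simp add: multiplicities_def sum_times_bool sum_negf)
  then show ?thesis
    by (simp add: sum_times_bool flip: of_nat_sum)
qed

text \<open>Scaling by \<open>p\<close> multiplies the bound, the charge and the weight by
  \<open>p\<close>; the restriction keeps the value \<open>undefined\<close> off the index
  set.\<close>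

lemma multiplicities_scale:
  assumes "p > 0"
  shows "{f \<in> multiplicities M (p * K) (p * m). \<forall>x\<in>{..M} \<times> UNIV. p dvd f x} =
    (\<lambda>g. \<lambda>x\<in>{..M} \<times> UNIV. p * g x) ` multiplicities M K m" (is "?L = ?h ` ?R")
proof (intro equalityI subsetI)
  let ?X = "{..M} \<times> (UNIV :: bool set)"
  have iff: "?h g \<in> multiplicities M (p * K) (p * m) \<longleftrightarrow> g \<in> ?R" if "g \<in> extensional ?X" for g
  proof -
    have "(\<Sum>x\<in>?X. charge x * int (?h g x)) = int p * (\<Sum>x\<in>?X. charge x * int (g x))"
      by (simp add: sum_distrib_left ac_simps cong: sum.cong)
    moreover have "(\<Sum>x\<in>?X. entry_weight x * ?h g x) = p * (\<Sum>x\<in>?X. entry_weight x * g x)"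
      by (simp add: sum_distrib_left ac_simps cong: sum.cong)
    moreover have "?h g \<in> ?X \<rightarrow>\<^sub>E {..p * K} \<longleftrightarrow> g \<in> ?X \<rightarrow>\<^sub>E {..K}"
      using assms that by (auto simp: PiE_iff)
    ultimately show ?thesis
      using assms by (simp add: multiplicities_def del: of_nat_mult)
  qed
  {
    fix f assume f: "f \<in> ?L"
    define g where "g = (\<lambda>x\<in>?X. f x div p)"
    have "?h g = f"
    proof
      fix x show "?h g x = f x"
        using f by (cases x; cases "fst x \<le> M") (auto simp: g_def multiplicities_def PiE_iff extensional_def)
    qed
    moreover have "g \<in> ?R"
      using iff[of g] f \<open>?h g = f\<close> by (simp add: g_def)
    ultimately show "f \<in> ?h ` ?R" by blast
  next
    fix f assume "f \<in> ?h ` ?R"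
    then obtain g where g: "g \<in> ?R" "f = ?h g" by blast
    moreover have "g \<in> extensional ?X" using g by (simp add: multiplicities_def PiE_def)
    ultimately show "f \<in> ?L" using iff[of g] by auto
  }
qed

lemma cphi_prime_mult_cong:
  fixes a :: nat
  assumes p: "prime p" and N: "\<not> p dvd N"
  defines "K \<equiv> p ^ a * N"
  shows "[cphi (p * K) n = (if p dvd n then cphi K (n div p) else 0)] (mod p ^ (2 * Suc a))"
proof -
  let ?X = "{..n} \<times> (UNIV :: bool set)"
  let ?c = "\<lambda>f. \<Prod>x\<in>?X. int ((p * K) choose f x)"
  define F where "F = {f \<in> multiplicities n (p * K) n. \<forall>x\<in>?X. p dvd f x}"
  have p0: "p > 0" using p by (simp add: prime_gt_0_nat)
  \<comment> \<open>The binomials at two distinct indices \<open>x\<close> and \<open>y\<close> each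
    contribute a factor \<open>p ^ Suc a\<close>.\<close>
  have zero: "[?c f = 0] (mod int (p ^ (2 * Suc a)))" if f: "f \<in> multiplicities n (p * K) n - F" for f
  proof -
    obtain x where x: "x \<in> ?X" "\<not> p dvd f x" using f by (auto simp: F_def)
    obtain y where y: "y \<in> ?X" "y \<noteq> x" "\<not> p dvd f y"
      using two_nonmultiples[of f n "p * K" n x p] x f by blast
    have dvd: "int (p ^ Suc a) dvd int ((p * K) choose f z)" if "\<not> p dvd f z" for z
      unfolding of_nat_dvd_iff by (rule prime_power_dvd_binomial[OF p _ that]) (simp add: K_def)
    have "int (p ^ Suc a) * int (p ^ Suc a) dvd (\<Prod>z\<in>{x, y}. int ((p * K) choose f z))"
      using y x dvd by (simp add: mult_dvd_mono del: power_Suc)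
    also have "\<dots> dvd ?c f" using x y by (intro prod_dvd_prod_subset) auto
    finally show ?thesis
      by (simp only: cong_0_iff mult_2 power_add of_nat_mult)
  qed
  have "int (cphi (p * K) n) = (\<Sum>f\<in>multiplicities n (p * K) n. ?c f)"
    by (simp add: cphi_eq_sum_binomials[of n n])
  also have "\<dots> = (\<Sum>f\<in>multiplicities n (p * K) n - F. ?c f) + sum ?c F"
    by (rule sum.subset_diff) (auto simp: F_def finite_multiplicities)
  also have "[\<dots> = (\<Sum>f\<in>multiplicities n (p * K) n - F. 0) + sum ?c F] (mod int (p ^ (2 * Suc a)))"
    by (intro cong_add cong_sum zero cong_refl)
  also have "(\<Sum>f\<in>multiplicities n (p * K) n - F. 0) + sum ?c F = sum ?c F"
    by simp
  also have "[sum ?c F = int (if p dvd n then cphi K (n div p) else 0)] (mod int (p ^ (2 * Suc a)))"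
  proof (cases "p dvd n")
    case False
    \<comment> \<open>The weight of such an \<open>f\<close> is a sum of multiples of
      \<open>p\<close>.\<close>
    have "p dvd n" if "f \<in> F" for f
    proof -
      have "p dvd (\<Sum>x\<in>?X. entry_weight x * f x)" using that by (intro dvd_sum) (auto simp: F_def)
      then show ?thesis using that by (simp add: F_def multiplicities_def)
    qed
    then have "F = {}" using False by blast
    then show ?thesis using False by simp
  next
    case True
    then obtain m where m: "n = p * m" by (elim dvdE)
    \<comment> \<open>This allows \<open>cphi K m\<close> to be expanded over the same index set,
      with bound \<open>n\<close> instead of \<open>m\<close>.\<close>
    have "m \<le> n" using m p0 by simp
    have inj: "inj_on (\<lambda>g. \<lambda>x\<in>?X. p * g x) (multiplicities n K m)"
    proof (rule inj_onI, rule ext)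
      fix g h x
      assume gh: "g \<in> multiplicities n K m" "h \<in> multiplicities n K m"
        and eq: "(\<lambda>x\<in>?X. p * g x) = (\<lambda>x\<in>?X. p * h x)"
      show "g x = h x"
        using fun_cong[OF eq, of x] gh p0
        by (cases x; cases "fst x \<le> n") (auto simp: multiplicities_def PiE_iff extensional_def)
    qed
    have "F = (\<lambda>g. \<lambda>x\<in>?X. p * g x) ` multiplicities n K m"
      using multiplicities_scale[OF p0, of n K m] by (simp add: F_def flip: m)
    then have "sum ?c F = (\<Sum>g\<in>multiplicities n K m. \<Prod>x\<in>?X. int ((p * K) choose (p * g x)))"
      using inj by (simp add: sum.reindex cong: prod.cong)
    also have "[\<dots> = (\<Sum>g\<in>multiplicities n K m. \<Prod>x\<in>?X. int (K choose g x))]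
        (mod int (p ^ (2 * Suc a)))"
    proof (rule cong_sum)
      fix g assume g: "g \<in> multiplicities n K m"
      show "[(\<Prod>x\<in>?X. int ((p * K) choose (p * g x))) = (\<Prod>x\<in>?X. int (K choose g x))]
          (mod int (p ^ (2 * Suc a)))"
        unfolding K_def of_nat_power
        by (rule prod_binomial_cong[OF p N])
          (use g even_sum_multiplicities[OF g] in \<open>auto simp: multiplicities_def K_def\<close>)
    qed
    also have "(\<Sum>g\<in>multiplicities n K m. \<Prod>x\<in>?X. int (K choose g x)) = int (cphi K m)"
      using \<open>m \<le> n\<close> by (simp add: cphi_eq_sum_binomials[of m n])
    finally show ?thesis using m p0 by simp
  qed
  finally show ?thesis by (simp only: cong_int_iff)
qed

theorem theorem5p3:
  fixes p N \<alpha> :: nat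
  assumes "prime p" and "N > 0" and "\<not> p dvd N" and "\<alpha> \<ge> 1"
  shows "(\<forall>n::nat. [cphi (p ^ \<alpha> * N) n =
             cphi_rat (p ^ (\<alpha> - 1) * N) (of_nat n / of_nat p)] (mod p ^ (2 * \<alpha>)))
       \<and> (\<forall>n r::nat. 1 \<le> r \<and> r \<le> p - 1 \<longrightarrow>
             [cphi (p ^ \<alpha> * N) (p * n + r) = 0] (mod p ^ (2 * \<alpha>)))
       \<and> (\<forall>n::nat. [cphi (p ^ \<alpha> * N) (p * n) =
             cphi (p ^ (\<alpha> - 1) * N) n] (mod p ^ (2 * \<alpha>)))"
proof -
  have p0: "p > 0" using assms(1) by (simp add: prime_gt_0_nat)
  obtain a where a: "\<alpha> = Suc a" using assms(4) by (cases \<alpha>) auto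
  \<comment> \<open>All three forms follow from this case distinction on
    \<open>p dvd n\<close>.\<close>
  have main: "[cphi (p ^ \<alpha> * N) n = (if p dvd n then cphi (p ^ (\<alpha> - 1) * N) (n div p) else 0)]
      (mod p ^ (2 * \<alpha>))" for n
    using cphi_prime_mult_cong[OF assms(1,3), of a n] by (simp only: a power_Suc mult.assoc diff_Suc_1)
  have rat: "cphi_rat k (of_nat n / of_nat p) = (if p dvd n then cphi k (n div p) else 0)" for k n
  proof (cases "p dvd n")
    case True
    then show ?thesis using p0 by (auto elim!: dvdE)
  next
    case False
    have "(of_nat n / of_nat p :: rat) \<notin> \<nat>"
    proof
      assume "(of_nat n / of_nat p :: rat) \<in> \<nat>"
      then obtain m where "(of_nat n / of_nat p :: rat) = of_nat m" by (auto elim: Nats_cases)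
      then have "(of_nat n :: rat) = of_nat (p * m)" using p0 by (simp add: field_simps)
      then show False using False by (simp only: of_nat_eq_iff) simp
    qed
    then show ?thesis using False by (simp add: cphi_rat_def)
  qed
  show ?thesis
  proof (intro conjI allI impI)
    fix n
    show "[cphi (p ^ \<alpha> * N) n = cphi_rat (p ^ (\<alpha> - 1) * N) (of_nat n / of_nat p)] (mod p ^ (2 * \<alpha>))"
      using main[of n] by (simp only: rat)
    show "[cphi (p ^ \<alpha> * N) (p * n) = cphi (p ^ (\<alpha> - 1) * N) n] (mod p ^ (2 * \<alpha>))"
      using main[of "p * n"] p0 by simp
    fix r assume "1 \<le> r \<and> r \<le> p - 1"
    then have "\<not> p dvd p * n + r" by (auto simp: dvd_add_right_iff dest: dvd_imp_le)
    then show "[cphi (p ^ \<alpha> * N) (p * n + r) = 0] (mod p ^ (2 * \<alpha>))"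
      using main[of "p * n + r"] by simp
  qed
qed

end
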